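(* The protocol described in the context guarantees Weak Causal Safety with certainty (100%): in every execution, if $m_1\to m_2$ and the causal chain from $m_1$ to $m_2$ passes exclusively through correct processes, then no correct process triggers bcrb_deliver$(m_2)$ before bcrb_deliver$(m_1)$.
   Context: Happens-before on application messages: if a process invokes bcrb_broadcast$(m)$ or bcrb_deliver$(m)$ before bcrb_broadcast$(m')$, then $m\to m'$; and $\to$ is transitive. System: asynchronous, $n$ processes, at most $f$ Byzantine (arbitrary, possibly colluding), $n\ge3f+1$; reliable authenticated point-to-point FIFO channels. A Byzantine Reliable Broadcast (BRB) primitive brb_broadcast/brb_deliver satisfies: Validity (if a correct process broadcasts $m$, all correct processes eventually deliver $m$), Agreement (if a correct process delivers $m$, all correct processes eventually do), Integrity (each message is delivered at most once by each correct process and, if the sender is correct, only if it was broadcast by the sender). There is a randomized $(n-f,n)$ threshold encryption scheme (public key $PK$, key shares $SK_i$) and a cryptographic hash function; ciphertexts are unpredictable, so the hash of a ciphertext cannot be computed before it has been broadcast. Protocol with BRB of ACKs (process $p_i$). State: $local\_sn=0$; vector $V_i=[0,\dots,0]$; set $pending=\emptyset$; share sets $shares[\cdot]=\emptyset$; directed graph $G=(N,E)$ of message IDs, initially empty. - bcrb_broadcast(payload): $local\_sn\leftarrow local\_sn+1$; encrypt the payload under $PK$; brb_broadcast$(i,local\_sn,ciphertext)$. - Upon brb_deliver$(j,sn,payload)$: wait until all $(j,s)$ with $s<sn$ are BRB-delivered and their brb_deliver processing is completed. If $payload$ is an ACK $[M=(k,sn^k),share,h]$: wait until all $(k,s')$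 with $s'\le sn^k$ are BRB-delivered and processed; if $M\in N$ and $h=hash(M.ciphertext)$, add $share$ to $shares[M]$ and add the edge $((j,sn+1)^{temp},(k,sn^k))$ to $E$ (a temporary node). Otherwise: $local\_sn\leftarrow local\_sn+1$; compute the decryption share of $payload$ with $SK_i$ and $h=hash(payload)$; brb_broadcast$(i,local\_sn,ACK[(j,sn),share,h])$. In both cases then: if $(j,sn)^{temp}$ exists relabel it $(j,sn)$, else add $(j,sn)$ to $N$; if $(j,sn-1)\in N$ add the edge $((j,sn),(j,sn-1))$; add $((j,sn),payload)$ to $pending$; run check_delivery. - check_delivery: repeatedly, for any $((j,sn),payload)\in pending$ with $V_i[j]=sn-1$, with $|shares[(j,sn)]|\ge n-f$ if $payload$ is not an ACK, and with no outgoing edge from $(j,sn)$ in $E$: remove it from $pending$, delete its node and incident edges from $G$, set $V_i[j]\leftarrow sn$, and, if $payload$ is not an ACK, decrypt and BCRB-deliver the plaintext (bcrb_deliver). *)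

theory Defs
  imports Main "HOL-Library.Cardinality"
begin

text \<open>
  Processes are the elements of a finite type \<open>'p\<close>, so \<open>n = CARD('p)\<close>.  A message of the protocol
  is named by its sender and sequence number.  Sequence numbers of correct processes start at 1 and
  are shared by application messages and ACKs.
\<close>

type_synonym 'p msgid = "'p \<times> nat"

text \<open>
  The type \<open>'ct\<close> may contain ill-formed ciphertexts, and shares and hashes in an ACK are arbitrary:
  this is what a Byzantine process can put into a broadcast, lucky guesses of hashes included.
\<close>

datatype ('p, 'ct, 'share, 'h) payload =
    App 'ct
  | Ack "'p msgid" 'share 'h

record ('p, 'pk, 'sk, 'pt, 'coins, 'ct, 'share, 'h) crypto =
  pub :: 'pk
  sec :: "'p \<Rightarrow> 'sk"
  enc :: "'pk \<Rightarrow> 'pt \<Rightarrow> 'coins \<Rightarrow> 'ct"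
  dec_share :: "'sk \<Rightarrow> 'ct \<Rightarrow> 'share"
  combine :: "'ct \<Rightarrow> 'share set \<Rightarrow> 'pt"
  hash :: "'ct \<Rightarrow> 'h"

text \<open>
  Functional correctness of a \<open>(k, n)\<close> threshold scheme, for every outcome of the encryption coins.
  Secrecy of the plaintext and unpredictability of ciphertexts are probabilistic properties; they
  would only exclude executions that have negligible probability, whereas safety with certainty
  is about all executions.
\<close>

definition threshold_scheme ::
  "nat \<Rightarrow> ('p::finite, 'pk, 'sk, 'pt, 'coins, 'ct, 'share, 'h) crypto \<Rightarrow> bool" where
  "threshold_scheme k Cr \<longleftrightarrow>
     (\<forall>x r A. k \<le> card A \<longrightarrow>
        (let c = enc Cr (pub Cr) x r
         in combine Cr c ((\<lambda>i. dec_share Cr (sec Cr i) c) ` A) = x))"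

text \<open>\<open>Temp m\<close> is the temporary node \<open>m\<^sup>t\<^sup>e\<^sup>m\<^sup>p\<close>.\<close>

datatype 'p node = Temp "'p msgid" | Node "'p msgid"

text \<open>
  Besides the variables of the protocol, a local state records the control state of the
  \<open>brb_deliver\<close> handlers: \<open>waiting\<close> holds the BRB-delivered messages whose handler is still blocked
  in a wait statement, \<open>running\<close> is the message whose handler is in its \<open>check_delivery\<close> loop, and
  \<open>processed\<close> are the messages whose handler has completed.  The history variable \<open>sent\<close> collects
  the arguments of all \<open>brb_broadcast\<close> invocations.
\<close>

record ('p, 'ct, 'share, 'h) lstate =
  local_sn :: nat
  vec :: "'p \<Rightarrow> nat"
  pending :: "('p msgid \<times> ('p, 'ct, 'share, 'h) payload) set"
  shares :: "'p msgid \<Rightarrow> 'share set"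
  nodes :: "'p node set"
  edges :: "('p node \<times> 'p node) set"
  waiting :: "('p msgid \<times> ('p, 'ct, 'share, 'h) payload) set"
  running :: "'p msgid option"
  processed :: "'p msgid set"
  sent :: "('p msgid \<times> ('p, 'ct, 'share, 'h) payload) set"

definition init :: "('p, 'ct, 'share, 'h) lstate" where
  "init = \<lparr>local_sn = 0, vec = (\<lambda>_. 0), pending = {}, shares = (\<lambda>_. {}), nodes = {}, edges = {},
           waiting = {}, running = None, processed = {}, sent = {}\<rparr>"

text \<open>
  The condition of the wait statements of the handler for message \<open>m\<close> with payload \<open>x\<close>.  An ACK has
  two of them in a row; both conditions are stable, so they are merged.
\<close>

definition waits_over ::
  "('p, 'ct, 'share, 'h) lstate \<Rightarrow> 'p msgid \<Rightarrow> ('p, 'ct, 'share, 'h) payload \<Rightarrow> bool" where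
  "waits_over s m x \<longleftrightarrow>
     (\<forall>q. 1 \<le> q \<and> q < snd m \<longrightarrow> (fst m, q) \<in> processed s) \<and>
     (case x of
        App c \<Rightarrow> True
      | Ack M sh h \<Rightarrow> (\<forall>q. 1 \<le> q \<and> q \<le> snd M \<longrightarrow> (fst M, q) \<in> processed s))"

text \<open>\<open>M.ciphertext\<close> is looked up in \<open>pending\<close>, where every non-temporary node has its payload.\<close>

definition receive_ack ::
  "('p, 'pk, 'sk, 'pt, 'coins, 'ct, 'share, 'h) crypto \<Rightarrow> 'p msgid \<Rightarrow> 'p msgid \<Rightarrow> 'share \<Rightarrow> 'h \<Rightarrow>
   ('p, 'ct, 'share, 'h) lstate \<Rightarrow> ('p, 'ct, 'share, 'h) lstate" where
  "receive_ack Cr m M sh h s =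
     (if Node M \<in> nodes s \<and> (\<exists>c. (M, App c) \<in> pending s \<and> h = hash Cr c)
      then s\<lparr>shares := (shares s)(M := insert sh (shares s M)),
             nodes := insert (Temp (fst m, snd m + 1)) (nodes s),
             edges := insert (Temp (fst m, snd m + 1), Node M) (edges s)\<rparr>
      else s)"

definition send_ack ::
  "('p, 'pk, 'sk, 'pt, 'coins, 'ct, 'share, 'h) crypto \<Rightarrow> 'p \<Rightarrow> 'p msgid \<Rightarrow> 'ct \<Rightarrow>
   ('p, 'ct, 'share, 'h) lstate \<Rightarrow> ('p, 'ct, 'share, 'h) lstate" where
  "send_ack Cr i m c s =
     (let sn = local_sn s + 1
      in s\<lparr>local_sn := sn,
           sent := insert ((i, sn), Ack m (dec_share Cr (sec Cr i) c) (hash Cr c)) (sent s)\<rparr>)"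

definition insert_message ::
  "'p msgid \<Rightarrow> ('p, 'ct, 'share, 'h) payload \<Rightarrow>
   ('p, 'ct, 'share, 'h) lstate \<Rightarrow> ('p, 'ct, 'share, 'h) lstate" where
  "insert_message m x s =
     (let relabel = (\<lambda>v. if v = Temp m then Node m else v);
          pred = {Node (fst m, q) | q. q + 1 = snd m}
      in s\<lparr>nodes := insert (Node m) (relabel ` nodes s),
           edges := map_prod relabel relabel ` edges s \<union> {Node m} \<times> (pred \<inter> nodes s),
           pending := insert (m, x) (pending s)\<rparr>)"

fun handle_body ::
  "('p, 'pk, 'sk, 'pt, 'coins, 'ct, 'share, 'h) crypto \<Rightarrow> 'p \<Rightarrow> 'p msgid \<Rightarrow>
   ('p, 'ct, 'share, 'h) payload \<Rightarrow>
   ('p, 'ct, 'share, 'h) lstate \<Rightarrow> ('p, 'ct, 'share, 'h) lstate" where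
  "handle_body Cr i m (Ack M sh h) s = insert_message m (Ack M sh h) (receive_ack Cr m M sh h s)"
| "handle_body Cr i m (App c) s = insert_message m (App c) (send_ack Cr i m c s)"

text \<open>The test \<open>V[j] = sn - 1\<close> is written without the truncated subtraction on \<open>nat\<close>.\<close>

definition deliverable ::
  "nat \<Rightarrow> ('p, 'ct, 'share, 'h) lstate \<Rightarrow> 'p msgid \<Rightarrow> ('p, 'ct, 'share, 'h) payload \<Rightarrow> bool" where
  "deliverable k s m x \<longleftrightarrow>
     (m, x) \<in> pending s \<and> vec s (fst m) + 1 = snd m \<and>
     (case x of App c \<Rightarrow> k \<le> card (shares s m) | Ack M sh h \<Rightarrow> True) \<and>
     (\<forall>v. (Node m, v) \<notin> edges s)"

definition remove_message ::
  "'p msgid \<Rightarrow> ('p, 'ct, 'share, 'h) payload \<Rightarrow>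
   ('p, 'ct, 'share, 'h) lstate \<Rightarrow> ('p, 'ct, 'share, 'h) lstate" where
  "remove_message m x s =
     s\<lparr>pending := pending s - {(m, x)},
       nodes := nodes s - {Node m},
       edges := {(u, v) \<in> edges s. u \<noteq> Node m \<and> v \<noteq> Node m},
       vec := (vec s)(fst m := snd m)\<rparr>"

text \<open>
  In \<open>Bcrb_Broadcast m pt\<close> and \<open>Bcrb_Deliver m pt\<close>, the application message is identified by the
  name \<open>m\<close> under which it is broadcast, as plaintexts need not be distinct.  \<open>Handle\<close> is the end of
  the waiting phase of a \<open>brb_deliver\<close> handler together with its body up to \<open>check_delivery\<close>,
  \<open>Discard_Ack\<close> is an iteration of \<open>check_delivery\<close> for an ACK, and \<open>Return\<close> is the end of its loop
  (and of the handler).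
\<close>

datatype ('p, 'pt, 'ct, 'share, 'h) action =
    Bcrb_Broadcast "'p msgid" 'pt
  | Brb_Deliver "'p msgid" "('p, 'ct, 'share, 'h) payload"
  | Handle "'p msgid" "('p, 'ct, 'share, 'h) payload"
  | Bcrb_Deliver "'p msgid" 'pt
  | Discard_Ack "'p msgid"
  | Return

text \<open>
  Steps of the correct process \<open>i\<close>, where \<open>k\<close> is the number of shares required for decryption.
  Handlers interleave only while they are waiting, but the application can invoke \<open>bcrb_broadcast\<close>
  at any time, in particular in response to a \<open>bcrb_deliver\<close> inside the \<open>check_delivery\<close> loop.
\<close>

inductive step ::
  "('p, 'pk, 'sk, 'pt, 'coins, 'ct, 'share, 'h) crypto \<Rightarrow> nat \<Rightarrow> 'p \<Rightarrow>
   ('p, 'ct, 'share, 'h) lstate \<Rightarrow> ('p, 'pt, 'ct, 'share, 'h) action \<Rightarrow>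
   ('p, 'ct, 'share, 'h) lstate \<Rightarrow> bool"
  for Cr :: "('p, 'pk, 'sk, 'pt, 'coins, 'ct, 'share, 'h) crypto" and k :: nat and i :: 'p
where
  bcrb_broadcast:
    "sn = local_sn s + 1 \<Longrightarrow>
     step Cr k i s (Bcrb_Broadcast (i, sn) pt)
       (s\<lparr>local_sn := sn, sent := insert ((i, sn), App (enc Cr (pub Cr) pt coins)) (sent s)\<rparr>)"
| brb_deliver:
    "step Cr k i s (Brb_Deliver m x) (s\<lparr>waiting := insert (m, x) (waiting s)\<rparr>)"
| handle:
    "(m, x) \<in> waiting s \<Longrightarrow> waits_over s m x \<Longrightarrow> running s = None \<Longrightarrow>
     step Cr k i s (Handle m x)
       (handle_body Cr i m x (s\<lparr>waiting := waiting s - {(m, x)}, running := Some m\<rparr>))"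
| bcrb_deliver:
    "running s \<noteq> None \<Longrightarrow> deliverable k s m (App c) \<Longrightarrow>
     step Cr k i s (Bcrb_Deliver m (combine Cr c (shares s m))) (remove_message m (App c) s)"
| discard_ack:
    "running s \<noteq> None \<Longrightarrow> deliverable k s m (Ack M sh h) \<Longrightarrow>
     step Cr k i s (Discard_Ack m) (remove_message m (Ack M sh h) s)"
| return:
    "running s = Some m \<Longrightarrow> (\<forall>m' x. \<not> deliverable k s m' x) \<Longrightarrow>
     step Cr k i s Return (s\<lparr>running := None, processed := insert m (processed s)\<rparr>)"

text \<open>
  An execution is an infinite interleaving: at time \<open>t\<close> at most one process acts, given by \<open>ev t\<close>, and
  \<open>conf t i\<close> is the state of process \<open>i\<close> before that.  Nothing is required of the processes outside
  the set \<open>C\<close> of correct processes.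
\<close>

type_synonym ('p, 'ct, 'share, 'h) configs = "nat \<Rightarrow> 'p \<Rightarrow> ('p, 'ct, 'share, 'h) lstate"
type_synonym ('p, 'pt, 'ct, 'share, 'h) events =
  "nat \<Rightarrow> ('p \<times> ('p, 'pt, 'ct, 'share, 'h) action) option"

definition execution ::
  "('p, 'pk, 'sk, 'pt, 'coins, 'ct, 'share, 'h) crypto \<Rightarrow> nat \<Rightarrow> 'p set \<Rightarrow>
   ('p, 'ct, 'share, 'h) configs \<Rightarrow> ('p, 'pt, 'ct, 'share, 'h) events \<Rightarrow> bool" where
  "execution Cr k C conf ev \<longleftrightarrow>
     (\<forall>i\<in>C. conf 0 i = init \<and>
       (\<forall>t. (\<forall>a. ev t = Some (i, a) \<longrightarrow> step Cr k i (conf t i) a (conf (Suc t) i)) \<and>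
            ((\<nexists>a. ev t = Some (i, a)) \<longrightarrow> conf (Suc t) i = conf t i)))"

text \<open>
  The BRB primitive.  A BRB message is identified by its (authenticated) sender and sequence number;
  in particular Integrity rules out two deliveries with the same name but different payloads.
\<close>

definition brb_validity ::
  "'p set \<Rightarrow> ('p, 'ct, 'share, 'h) configs \<Rightarrow> ('p, 'pt, 'ct, 'share, 'h) events \<Rightarrow> bool" where
  "brb_validity C conf ev \<longleftrightarrow>
     (\<forall>j\<in>C. \<forall>t m x. (m, x) \<in> sent (conf t j) \<longrightarrow> (\<forall>i\<in>C. \<exists>t'. ev t' = Some (i, Brb_Deliver m x)))"

definition brb_agreement ::
  "'p set \<Rightarrow> ('p, 'pt, 'ct, 'share, 'h) events \<Rightarrow> bool" where
  "brb_agreement C ev \<longleftrightarrow>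
     (\<forall>j\<in>C. \<forall>t m x. ev t = Some (j, Brb_Deliver m x) \<longrightarrow>
        (\<forall>i\<in>C. \<exists>t'. ev t' = Some (i, Brb_Deliver m x)))"

definition brb_integrity ::
  "'p set \<Rightarrow> ('p, 'ct, 'share, 'h) configs \<Rightarrow> ('p, 'pt, 'ct, 'share, 'h) events \<Rightarrow> bool" where
  "brb_integrity C conf ev \<longleftrightarrow>
     (\<forall>i\<in>C. \<forall>t m x. ev t = Some (i, Brb_Deliver m x) \<longrightarrow>
        (\<forall>t' x'. ev t' = Some (i, Brb_Deliver m x') \<longrightarrow> t' = t) \<and>
        (fst m \<in> C \<longrightarrow> (m, x) \<in> sent (conf t (fst m))))"

text \<open>
  Happens-before on application messages along causal chains all of whose steps are made by processes
  in \<open>P\<close>; unrestricted happens-before is the case \<open>P = UNIV\<close>.  The first message of a chain may come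
  from any process if the chain begins with its delivery.
\<close>

inductive causal_chain ::
  "'p set \<Rightarrow> ('p, 'pt, 'ct, 'share, 'h) events \<Rightarrow> 'p msgid \<Rightarrow> 'p msgid \<Rightarrow> bool"
  for P :: "'p set" and ev :: "('p, 'pt, 'ct, 'share, 'h) events"
where
  broadcast_broadcast:
    "p \<in> P \<Longrightarrow> t < t' \<Longrightarrow> ev t = Some (p, Bcrb_Broadcast m pt) \<Longrightarrow>
     ev t' = Some (p, Bcrb_Broadcast m' pt') \<Longrightarrow> causal_chain P ev m m'"
| deliver_broadcast:
    "p \<in> P \<Longrightarrow> t < t' \<Longrightarrow> ev t = Some (p, Bcrb_Deliver m pt) \<Longrightarrow>
     ev t' = Some (p, Bcrb_Broadcast m' pt') \<Longrightarrow> causal_chain P ev m m'"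
| trans:
    "causal_chain P ev m m' \<Longrightarrow> causal_chain P ev m' m'' \<Longrightarrow> causal_chain P ev m m''"

definition weak_causal_safety ::
  "'p set \<Rightarrow> ('p, 'pt, 'ct, 'share, 'h) events \<Rightarrow> bool" where
  "weak_causal_safety C ev \<longleftrightarrow>
     (\<forall>m1 m2. causal_chain C ev m1 m2 \<longrightarrow>
        (\<forall>i\<in>C. \<forall>t pt. ev t = Some (i, Bcrb_Deliver m2 pt) \<longrightarrow>
           (\<exists>t'<t. \<exists>pt'. ev t' = Some (i, Bcrb_Deliver m1 pt'))))"

end

theory Submission
  imports Defs
begin

text \<open>
  Suppose that \<open>p\<close> delivers \<open>M\<close> and later broadcasts \<open>m'\<close>.  Between them lies the ACK \<open>(p, a)\<close> of
  \<open>p\<close> for \<open>M\<close>.  When another correct process handles this ACK, it has already processed \<open>M\<close>, so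
  either \<open>M\<close> has been delivered or an edge from \<open>(p, a + 1)\<close> to \<open>M\<close> is created; this edge persists,
  up to relabelling of its source, until \<open>M\<close> is delivered, and it blocks \<open>(p, a + 1)\<close>.  As the
  messages of \<open>p\<close> leave the graph in the order of their sequence numbers, it also blocks \<open>m'\<close>.  Two
  broadcasts of the same process are ordered by their sequence numbers alone.  Since the ordering
  property of a single link of a chain holds at every correct process, it composes along chains.
\<close>

declare split_paired_All [simp del] split_paired_Ex [simp del]

section \<open>State predicates and the effect of single steps\<close>

text \<open>Messages of one sender leave the graph in the order of their numbers, starting from 1,
  so the vector alone records which have left. The lower bound keeps number 0 from counting as
  removed in the initial state.\<close>

definition removed :: "('p, 'ct, 'share, 'h) lstate \<Rightarrow> 'p msgid \<Rightarrow> bool" where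
  "removed s m \<longleftrightarrow> 1 \<le> snd m \<and> snd m \<le> vec s (fst m)"

definition is_pending :: "('p, 'ct, 'share, 'h) lstate \<Rightarrow> 'p msgid \<Rightarrow> bool" where
  "is_pending s m \<longleftrightarrow> (\<exists>x. (m, x) \<in> pending s)"

text \<open>This captures that the body of the handler for \<open>m\<close> has run, whether or not
  its \<open>check_delivery\<close> loop has ended; \<open>processed\<close> implies it.\<close>

definition handled :: "('p, 'ct, 'share, 'h) lstate \<Rightarrow> 'p msgid \<Rightarrow> bool" where
  "handled s m \<longleftrightarrow> is_pending s m \<or> removed s m"

lemma handle_body_simps [simp]:
  "vec (handle_body Cr i m x s) = vec s"
  "pending (handle_body Cr i m x s) = insert (m, x) (pending s)"
  "waiting (handle_body Cr i m x s) = waiting s"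
  "running (handle_body Cr i m x s) = running s"
  "processed (handle_body Cr i m x s) = processed s"
  by (cases x; simp add: receive_ack_def send_ack_def insert_message_def Let_def)+

lemma handle_body_nodes: "Node m' \<in> nodes s \<or> m' = m \<Longrightarrow> Node m' \<in> nodes (handle_body Cr i m x s)"
  by (cases x) (force simp: receive_ack_def send_ack_def insert_message_def Let_def)+

text \<open>Relabelling fixes every \<open>Node\<close>, so an edge into a permanent node survives
  and can change only at its source.\<close>

lemma handle_body_edges:
  assumes "(u, Node M) \<in> edges s"
  shows "(if u = Temp m then Node m else u, Node M) \<in> edges (handle_body Cr i m x s)"
  using assms
  by (cases x)
    (force simp: receive_ack_def send_ack_def insert_message_def Let_def map_prod_def)+

text \<open>The new source carries the number \<open>snd m + 1\<close>, so the relabelling of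
  \<open>Temp m\<close> later in the same body leaves it temporary.\<close>

lemma handle_ack_edges:
  assumes "Node M \<in> nodes s" "(M, App c) \<in> pending s"
  shows "(Temp (fst m, snd m + 1), Node M) \<in> edges (handle_body Cr i m (Ack M sh (hash Cr c)) s)"
  using assms
  by (cases m) (force simp: receive_ack_def insert_message_def Let_def map_prod_def)

lemma remove_message_simps [simp]:
  "vec (remove_message m x s) = (vec s)(fst m := snd m)"
  "pending (remove_message m x s) = pending s - {(m, x)}"
  "nodes (remove_message m x s) = nodes s - {Node m}"
  "edges (remove_message m x s) = {(u, v) \<in> edges s. u \<noteq> Node m \<and> v \<noteq> Node m}"
  "waiting (remove_message m x s) = waiting s"
  "running (remove_message m x s) = running s"
  "processed (remove_message m x s) = processed s"
  "sent (remove_message m x s) = sent s"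
  "local_sn (remove_message m x s) = local_sn s"
  by (simp_all add: remove_message_def)

lemma sent_handle_body:
  "sent (handle_body Cr i m x s) =
     (case x of
        App c \<Rightarrow> insert ((i, local_sn s + 1), Ack m (dec_share Cr (sec Cr i) c) (hash Cr c)) (sent s)
      | Ack M sh h \<Rightarrow> sent s)"
  "local_sn (handle_body Cr i m x s) =
     (case x of App c \<Rightarrow> local_sn s + 1 | Ack M sh h \<Rightarrow> local_sn s)"
  by (cases x; simp add: receive_ack_def send_ack_def insert_message_def Let_def)+

text \<open>Both kinds of removal at once; the action matters only for \<open>Bcrb_Deliver\<close>.\<close>

lemma step_cases [consumes 1, case_names broadcast brb_deliver handle remove return]:
  assumes "step Cr k i s a s'"
  obtains sn pt coins where "sn = local_sn s + 1" "a = Bcrb_Broadcast (i, sn) pt"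
      "s' = s\<lparr>local_sn := sn, sent := insert ((i, sn), App (enc Cr (pub Cr) pt coins)) (sent s)\<rparr>"
  | m x where "a = Brb_Deliver m x" "s' = s\<lparr>waiting := insert (m, x) (waiting s)\<rparr>"
  | m x where "a = Handle m x" "(m, x) \<in> waiting s" "waits_over s m x"
      "s' = handle_body Cr i m x (s\<lparr>waiting := waiting s - {(m, x)}, running := Some m\<rparr>)"
  | m x where "deliverable k s m x" "s' = remove_message m x s"
      "\<And>c. x = App c \<Longrightarrow> \<exists>pt. a = Bcrb_Deliver m pt"
  | m where "running s = Some m" "s' = s\<lparr>running := None, processed := insert m (processed s)\<rparr>"
  using assms
proof cases
  case bcrb_broadcast
  then show ?thesis using that(1) by blast
next
  case brb_deliver
  then show ?thesis by (rule that(2))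
next
  case handle
  then show ?thesis using that(3) by blast
next
  case bcrb_deliver
  then show ?thesis using that(4) by blast
next
  case discard_ack
  then show ?thesis using that(4) by blast
next
  case return
  then show ?thesis using that(5) by blast
qed

lemma deliverableD:
  assumes "deliverable k s m x"
  shows "(m, x) \<in> pending s" "vec s (fst m) + 1 = snd m" "(Node m, v) \<notin> edges s"
  using assms by (auto simp: deliverable_def)

text \<open>The test \<open>vec s (fst m) + 1 = snd m\<close> makes the vector advance by exactly
  one, so no other message becomes removed.\<close>

lemma removed_remove_message:
  assumes "deliverable k s m x"
  shows "removed (remove_message m x s) m' \<longleftrightarrow> m' = m \<or> removed s m'"
  using deliverableD(2)[OF assms] by (cases m; cases m') (auto simp: removed_def)

lemma handled_remove_message:
  assumes "deliverable k s m x" "handled (remove_message m x s) m'"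
  shows "handled s m'"
  using assms deliverableD(1)[OF assms(1)]
  by (auto simp: handled_def is_pending_def removed_remove_message)

lemma removed_mono:
  assumes "step Cr k i s a s'" "removed s m"
  shows "removed s' m"
  using assms by (cases rule: step_cases) (auto simp: removed_def deliverable_def)

lemma handled_mono:
  assumes "step Cr k i s a s'" "handled s m"
  shows "handled s' m"
  using assms
  by (cases rule: step_cases) (auto simp: handled_def is_pending_def removed_def deliverable_def)

lemma sent_mono:
  assumes "step Cr k i s a s'"
  shows "sent s \<subseteq> sent s'" "local_sn s \<le> local_sn s'"
  using assms
  by (cases rule: step_cases; auto simp: sent_handle_body split: payload.splits)+

section \<open>Executions, numbering of broadcasts, and the BRB guarantees\<close>

locale brb_execution =
  fixes Cr :: "('p, 'pk, 'sk, 'pt, 'coins, 'ct, 'share, 'h) crypto"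
    and k :: nat
    and C :: "'p set"
    and conf :: "('p, 'ct, 'share, 'h) configs"
    and ev :: "('p, 'pt, 'ct, 'share, 'h) events"
  assumes execution: "execution Cr k C conf ev"
    and agreement: "brb_agreement C ev"
    and integrity: "brb_integrity C conf ev"
begin

lemma conf_0: "i \<in> C \<Longrightarrow> conf 0 i = init"
  using execution by (auto simp: execution_def)

lemma conf_step: "i \<in> C \<Longrightarrow> ev t = Some (i, a) \<Longrightarrow> step Cr k i (conf t i) a (conf (Suc t) i)"
  using execution by (auto simp: execution_def)

lemma conf_cases:
  assumes "i \<in> C"
  obtains "conf (Suc t) i = conf t i"
  | a where "ev t = Some (i, a)" "step Cr k i (conf t i) a (conf (Suc t) i)"
  using execution assms by (cases "\<exists>a. ev t = Some (i, a)") (auto simp: execution_def)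

text \<open>The predicate takes the time as well as the state because some invariants refer to the
  events before that time.\<close>

lemma conf_induct [consumes 2, case_names init idle step]:
  assumes "i \<in> C" "s = conf t i" "P 0 init"
    and "\<And>t s. P t s \<Longrightarrow> P (Suc t) s"
    and "\<And>t a s s'. P t s \<Longrightarrow> s = conf t i \<Longrightarrow> s' = conf (Suc t) i \<Longrightarrow> ev t = Some (i, a) \<Longrightarrow>
          step Cr k i s a s' \<Longrightarrow> P (Suc t) s'"
  shows "P t s"
  unfolding assms(2)
proof (induction t)
  case 0
  then show ?case using assms(1,3) by (simp add: conf_0)
next
  case (Suc t)
  then show ?case by (metis assms(1,4,5) conf_cases)
qed

lemma sent_conf_mono:
  assumes "i \<in> C" "t \<le> t'"
  shows "sent (conf t i) \<subseteq> sent (conf t' i)" "local_sn (conf t i) \<le> local_sn (conf t' i)"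
proof -
  have "sent (conf t i) \<subseteq> sent (conf t' i) \<and> local_sn (conf t i) \<le> local_sn (conf t' i)"
    using assms(2)
  proof (induction t' rule: dec_induct)
    case (step t')
    show ?case
      using assms(1) by (cases rule: conf_cases[of i t']) (use step sent_mono in \<open>force+\<close>)
  qed simp
  then show "sent (conf t i) \<subseteq> sent (conf t' i)" "local_sn (conf t i) \<le> local_sn (conf t' i)"
    by auto
qed

text \<open>Every broadcast takes the number \<open>local_sn s + 1\<close>, which is fresh by the
  bound; hence uniqueness of payloads is proved together with the bound.\<close>

lemma sent_numbering:
  assumes "i \<in> C" "s = conf t i"
  shows "(\<forall>(m, x) \<in> sent s. fst m = i \<and> 1 \<le> snd m \<and> snd m \<le> local_sn s) \<and>
    (\<forall>m x y. (m, x) \<in> sent s \<longrightarrow> (m, y) \<in> sent s \<longrightarrow> x = y)"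
  using assms
proof (induction t s rule: conf_induct)
  case init
  then show ?case by (simp add: init_def)
next
  case (step t a s s')
  from step(5) show ?case
    by (cases rule: step_cases)
      (use step(1) in \<open>fastforce simp: sent_handle_body split: payload.splits\<close>)+
qed

lemma sent_unique:
  assumes "i \<in> C" "(m, x) \<in> sent (conf t i)" "(m, y) \<in> sent (conf t' i)"
  shows "x = y"
proof -
  have "(m, x) \<in> sent (conf (max t t') i)" "(m, y) \<in> sent (conf (max t t') i)"
    using sent_conf_mono(1)[OF assms(1)] assms(2,3) by (meson max.cobounded1 max.cobounded2 subsetD)+
  with sent_numbering[OF assms(1) refl] show ?thesis by blast
qed

lemma brb_unique:
  assumes "i \<in> C" "ev t = Some (i, Brb_Deliver m x)" "ev t' = Some (i, Brb_Deliver m y)"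
  shows "t' = t" "x = y"
proof -
  show "t' = t" using integrity assms unfolding brb_integrity_def by blast
  with assms show "x = y" by simp
qed

lemma brb_agreed:
  assumes "i \<in> C" "j \<in> C" "ev t = Some (j, Brb_Deliver m x)"
  obtains t' where "ev t' = Some (i, Brb_Deliver m x)"
  using agreement assms unfolding brb_agreement_def by blast

lemma brb_authentic:
  assumes "i \<in> C" "ev t = Some (i, Brb_Deliver m x)" "fst m \<in> C"
  shows "(m, x) \<in> sent (conf t (fst m))"
  using integrity assms unfolding brb_integrity_def by blast

section \<open>Invariants of a single correct process\<close>

text \<open>This turns facts about the state into past events. The state no longer holds the payload
  of a removed message, hence the existential quantifier; if it was an application payload, the
  removing step was a \<open>Bcrb_Deliver\<close>.\<close>

lemma delivered_before:
  assumes "i \<in> C" "s = conf t i"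
  shows "(\<forall>m x. (m, x) \<in> waiting s \<union> pending s \<longrightarrow> (\<exists>t'<t. ev t' = Some (i, Brb_Deliver m x))) \<and>
    (\<forall>m. removed s m \<longrightarrow>
      (\<exists>x. (\<exists>t'<t. ev t' = Some (i, Brb_Deliver m x)) \<and>
           (\<forall>c. x = App c \<longrightarrow> (\<exists>t'<t. \<exists>pt. ev t' = Some (i, Bcrb_Deliver m pt)))))"
    (is "?A t s \<and> ?B t s")
  using assms
proof (induction t s rule: conf_induct)
  case init
  then show ?case by (simp add: init_def removed_def)
next
  case (idle t s)
  then show ?case by (meson less_Suc_eq)
next
  case (step t a s s')
  then have AB: "?A (Suc t) s \<and> ?B (Suc t) s" by (meson less_Suc_eq)
  from step(5) show ?case
  proof (cases rule: step_cases)
    case (brb_deliver m x)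
    with AB step(4) show ?thesis by (auto simp: removed_def)
  next
    case (remove m x)
    have x: "(m, x) \<in> pending s" using remove(1) by (rule deliverableD)
    then obtain t' where t': "t' < Suc t" "ev t' = Some (i, Brb_Deliver m x)" using AB by blast
    have "?B (Suc t) s'"
    proof (intro allI impI)
      fix m' assume "removed s' m'"
      then consider "m' = m" | "removed s m'"
        by (auto simp: remove(2) removed_remove_message[OF remove(1)])
      then show "\<exists>x. (\<exists>t'<Suc t. ev t' = Some (i, Brb_Deliver m' x)) \<and>
           (\<forall>c. x = App c \<longrightarrow> (\<exists>t'<Suc t. \<exists>pt. ev t' = Some (i, Bcrb_Deliver m' pt)))"
      proof cases
        case 1
        have "\<forall>c. x = App c \<longrightarrow> (\<exists>t'<Suc t. \<exists>pt. ev t' = Some (i, Bcrb_Deliver m' pt))"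
          using remove(3) step(4) 1 by auto
        with t' 1 show ?thesis by auto
      qed (use AB in blast)
    qed
    moreover have "?A (Suc t) s'" using AB by (simp add: remove(2))
    ultimately show ?thesis by blast
  qed (use AB in \<open>auto simp: removed_def\<close>)
qed

lemma handled_brb_delivered:
  assumes "i \<in> C" "handled (conf t i) m"
  shows "\<exists>x. \<exists>t'<t. ev t' = Some (i, Brb_Deliver m x)"
  using delivered_before[OF assms(1) refl, of t] assms(2) unfolding handled_def is_pending_def by blast

text \<open>BRB Integrity delivers each name once, so a message whose handler body has run never
  waits again. Thus a message being handled is neither pending nor removed beforehand.\<close>

lemma handled_once:
  assumes "i \<in> C" "s = conf t i"
  shows "(\<forall>m. running s = Some m \<or> m \<in> processed s \<longrightarrow> handled s m) \<and>
    (\<forall>m x. (m, x) \<in> waiting s \<longrightarrow> \<not> handled s m)"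
  using assms
proof (induction t s rule: conf_induct)
  case init
  then show ?case by (simp add: init_def)
next
  case (step t a s s')
  note mono = handled_mono[OF step(5)]
  from step(5) show ?case
  proof (cases rule: step_cases)
    case (brb_deliver m x)
    \<comment> \<open>A handled message was BRB-delivered strictly before \<open>t\<close>, so by
      Integrity it cannot be the one delivered at \<open>t\<close>.\<close>
    have "\<not> handled s m"
      using handled_brb_delivered[OF assms(1)] brb_unique[OF assms(1)] step(2,4) brb_deliver(1) by blast
    with step(1) brb_deliver show ?thesis by (auto simp: handled_def is_pending_def removed_def)
  next
    case (handle m x)
    have "y = x" if "(m, y) \<in> waiting s" for y
      using delivered_before[OF assms(1) step(2)] that handle(2) brb_unique(2)[OF assms(1)] by blast
    then have "m' \<noteq> m" if "(m', y) \<in> waiting s'" for m' y using that by (auto simp: handle(4))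
    moreover have "handled s' m' \<longleftrightarrow> m' = m \<or> handled s m'" for m'
      by (auto simp: handle(4) handled_def is_pending_def removed_def)
    ultimately show ?thesis using step(1) by (auto simp: handle(4))
  next
    case (remove m x)
    have "handled s m'" if "handled s' m'" for m'
      using handled_remove_message[OF remove(1)] that by (simp add: remove(2))
    with step(1) mono show ?thesis by (auto simp: remove(2))
  qed (use step(1) in \<open>auto simp: handled_def is_pending_def removed_def\<close>)
qed simp

text \<open>Removal deletes a node by its name but a pending entry by name and payload; the two
  agree because a name is BRB-delivered with only one payload.\<close>

lemma pending_node:
  assumes "i \<in> C" "s = conf t i"
  shows "\<forall>m. is_pending s m \<longrightarrow> Node m \<in> nodes s"
  using assms
proof (induction t s rule: conf_induct)
  case init
  then show ?case by (simp add: init_def is_pending_def)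
next
  case (step t a s s')
  have uniq: "y = x" if "(m, y) \<in> pending s" "(m, x) \<in> pending s" for m x y
    using delivered_before[OF assms(1) step(2)] that brb_unique(2)[OF assms(1)]
    by blast
  from step(5) show ?case
  proof (cases rule: step_cases)
    case (handle m x)
    with step(1) show ?thesis by (auto simp: is_pending_def intro!: handle_body_nodes)
  next
    case (remove m x)
    have "m' \<noteq> m" if "is_pending s' m'" for m'
      using that uniq[OF _ deliverableD(1)[OF remove(1)]]
      by (auto simp: remove(2) is_pending_def)
    with step(1) show ?thesis by (auto simp: remove(2) is_pending_def)
  qed (use step(1) in \<open>auto simp: is_pending_def\<close>)
qed simp

text \<open>The wait for smaller numbers of the same sender puts them in \<open>processed\<close>,
  hence they are handled, and they remain so.\<close>

lemma handled_in_order: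
  assumes "i \<in> C" "s = conf t i"
  shows "\<forall>m q. is_pending s m \<longrightarrow> 1 \<le> q \<longrightarrow> q < snd m \<longrightarrow> handled s (fst m, q)"
  using assms
proof (induction t s rule: conf_induct)
  case init
  then show ?case by (simp add: init_def is_pending_def)
next
  case (step t a s s')
  note mono = handled_mono[OF step(5)]
  have "handled s (fst m, q)" if "is_pending s' m" "1 \<le> q" "q < snd m" for m q
    using step(5)
  proof (cases rule: step_cases)
    case (handle m' x)
    show ?thesis
    proof (cases "m = m'")
      case True
      then have "(fst m, q) \<in> processed s" using handle(3) that by (simp add: waits_over_def)
      then show ?thesis using handled_once[OF assms(1) step(2)] by blast
    next
      case False
      then have "is_pending s m" using that(1) by (simp add: handle(4) is_pending_def)
      then show ?thesis using step(1) that by blast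
    qed
  qed (use that step(1) in \<open>auto simp: is_pending_def\<close>)
  with mono show ?case by blast
qed simp

section \<open>The edge created by an ACK as a blocking invariant\<close>

text \<open>Both forms of the edge keep \<open>(p, a + 1)\<close> from being removed: as a
  \<open>Node\<close> it has an outgoing edge, and as a \<open>Temp\<close> it is not yet pending.
  The bound on \<open>vec s p\<close> then says that no message of \<open>p\<close> beyond the ACK
  has left the graph.\<close>

lemma ack_blocks:
  assumes "i \<in> C" "s = conf t i" "1 \<le> a" "1 \<le> snd M"
    and "ev tA = Some (i, Brb_Deliver (p, a) (Ack M sh (hash Cr c)))"
    and "ev tM = Some (i, Brb_Deliver M (App c))"
  shows "handled s (p, a) \<longrightarrow> removed s M \<or>
    (vec s p \<le> a \<and>
     ((Node (p, a + 1), Node M) \<in> edges s \<or>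
      (Temp (p, a + 1), Node M) \<in> edges s \<and> \<not> is_pending s (p, a + 1)))"
    (is "?P s")
  using assms(1,2)
proof (induction t s rule: conf_induct)
  case init
  then show ?case by (simp add: init_def handled_def is_pending_def removed_def)
next
  case (step t act s s')
  note mono = removed_mono[OF step(5), of M]
  from step(5) show ?case
  proof (cases rule: step_cases)
    case (handle m x)
    let ?s = "s\<lparr>waiting := waiting s - {(m, x)}, running := Some m\<rparr>"
    have brb: "\<exists>t'. ev t' = Some (i, Brb_Deliver m' y)"
      if "(m', y) \<in> waiting s \<union> pending s" for m' y
      using delivered_before[OF assms(1) step(2)] that by blast
    have fresh: "\<not> handled s m"
      using handled_once[OF assms(1) step(2)] handle(2) by blast
    show ?thesis
    proof (cases "m = (p, a)")
      case True
      then have x: "x = Ack M sh (hash Cr c)"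
        using brb[of m x] handle(2) brb_unique(2)[OF assms(1,5)] by blast
      \<comment> \<open>The second wait of an ACK handler covers the number \<open>snd M\<close>
        itself; it quantifies over numbers from 1 on, hence \<open>1 \<le> snd M\<close>.\<close>
      have "M \<in> processed s"
        using handle(3) assms(4) by (cases M) (auto simp: waits_over_def x)
      then have "handled s M" using handled_once[OF assms(1) step(2)] by blast
      then consider "removed s M" | y where "(M, y) \<in> pending s"
        by (auto simp: handled_def is_pending_def)
      then show ?thesis
      proof cases
        case 2
        \<comment> \<open>The pending payload is the very ciphertext whose hash the ACK carries, so
          the hash test succeeds and the edge is created.\<close>
        then have y: "y = App c" using brb[of M y] brb_unique(2)[OF assms(1,6)] by blast
        have "Node M \<in> nodes s"
          using pending_node[OF assms(1) step(2)] 2 unfolding is_pending_def by blast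
        then have "(Temp (p, a + 1), Node M) \<in> edges s'"
          using handle_ack_edges[of M ?s c m Cr i sh] 2 by (simp add: handle(4) x y True)
        moreover have "vec s p \<le> a" using fresh True assms(3) by (auto simp: handled_def removed_def)
        \<comment> \<open>Were the successor pending, its predecessor \<open>(p, a)\<close> would
          already be handled.\<close>
        moreover have "\<not> is_pending s (p, a + 1)"
          using handled_in_order[OF assms(1) step(2)] fresh True assms(3) by fastforce
        ultimately show ?thesis using True by (simp add: handle(4) is_pending_def)
      qed (use mono in blast)
    next
      case False
      show ?thesis
      proof
        assume "handled s' (p, a)"
        then have "handled s (p, a)"
          using False by (auto simp: handle(4) handled_def is_pending_def removed_def)
        with step(1) mono
        consider "removed s' M" | "vec s p \<le> a" "(Node (p, a + 1), Node M) \<in> edges s"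
          | "vec s p \<le> a" "(Temp (p, a + 1), Node M) \<in> edges s" "\<not> is_pending s (p, a + 1)"
          by blast
        then show "removed s' M \<or> (vec s' p \<le> a \<and> ((Node (p, a + 1), Node M) \<in> edges s' \<or>
           (Temp (p, a + 1), Node M) \<in> edges s' \<and> \<not> is_pending s' (p, a + 1)))"
        proof cases
          case 2
          then show ?thesis
            using handle_body_edges[of "Node (p, a + 1)" M ?s m Cr i x] by (simp add: handle(4))
        next
          case 3
          \<comment> \<open>If the message handled is \<open>(p, a + 1)\<close>, the temporary
            source becomes permanent; otherwise the successor stays non-pending.\<close>
          then show ?thesis
            using handle_body_edges[of "Temp (p, a + 1)" M ?s m Cr i x]
            by (auto simp: handle(4) is_pending_def split: if_splits)
        qed simp
      qed
    qed
  next
    case (remove m x)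
    note del = deliverableD[OF remove(1)]
    show ?thesis
    proof
      assume "handled s' (p, a)"
      then have "handled s (p, a)"
        using handled_remove_message[OF remove(1)] by (simp add: remove(2))
      with step(1) mono consider "removed s' M" | "vec s p \<le> a"
        "(Node (p, a + 1), Node M) \<in> edges s \<or>
         (Temp (p, a + 1), Node M) \<in> edges s \<and> \<not> is_pending s (p, a + 1)"
        by blast
      then show "removed s' M \<or> (vec s' p \<le> a \<and> ((Node (p, a + 1), Node M) \<in> edges s' \<or>
           (Temp (p, a + 1), Node M) \<in> edges s' \<and> \<not> is_pending s' (p, a + 1)))"
      proof cases
        case 2
        \<comment> \<open>A message of \<open>p\<close> removed now has number
          \<open>vec s p + 1\<close>, at most \<open>a + 1\<close>; as it is not
          \<open>a + 1\<close>, the bound on the vector survives. The edge itself is lost only if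
          \<open>m = M\<close>, and then \<open>M\<close> is removed.\<close>
        then have "m \<noteq> (p, a + 1)" using del by (auto simp: is_pending_def)
        moreover have "removed s' M" if "m = M"
          using that assms(4) by (simp add: remove(2) removed_def)
        ultimately show ?thesis using 2 del(2)
          by (cases m) (auto simp: remove(2) is_pending_def)
      qed simp
    qed
  qed (use step(1) in \<open>auto simp: handled_def is_pending_def removed_def\<close>)
qed simp

text \<open>The ACK is sent in the same handler body that makes the message pending, so its number
  precedes those of all later broadcasts.\<close>

lemma pending_acked:
  assumes "i \<in> C" "s = conf t i"
  shows "\<forall>m c. (m, App c) \<in> pending s \<longrightarrow>
    (\<exists>a sh. ((i, a), Ack m sh (hash Cr c)) \<in> sent s)"
  using assms
proof (induction t s rule: conf_induct)
  case init
  then show ?case by (simp add: init_def)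
next
  case (step t a s s')
  from step(5) show ?case
    by (cases rule: step_cases)
      (use step(1) in \<open>fastforce simp: sent_handle_body split: payload.splits\<close>)+
qed simp

section \<open>Links of a causal chain and their composition\<close>

lemma bcrb_deliver_step:
  assumes "i \<in> C" "ev t = Some (i, Bcrb_Deliver m pt)"
  obtains c where "deliverable k (conf t i) m (App c)"
  using conf_step[OF assms] by cases

lemma bcrb_broadcast_step:
  assumes "i \<in> C" "ev t = Some (i, Bcrb_Broadcast m pt)"
  obtains c where "m = (i, local_sn (conf t i) + 1)" "(m, App c) \<in> sent (conf (Suc t) i)"
    "local_sn (conf (Suc t) i) = snd m"
  using conf_step[OF assms] by cases auto

text \<open>The assumption on the payload rules out that \<open>m\<close> left the graph as an
  ACK.\<close>

lemma removed_application_message: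
  assumes "i \<in> C" "removed (conf t i) m"
    and "\<And>t' x. ev t' = Some (i, Brb_Deliver m x) \<Longrightarrow> x = App c"
  shows "\<exists>t'<t. \<exists>pt. ev t' = Some (i, Bcrb_Deliver m pt)"
  using delivered_before[OF assms(1) refl, of t] assms(2,3) by blast

lemma broadcast_broadcast_safe:
  assumes "p \<in> C" "t1 < t2"
    and "ev t1 = Some (p, Bcrb_Broadcast m pt1)" "ev t2 = Some (p, Bcrb_Broadcast m' pt2)"
    and "i \<in> C" "ev t = Some (i, Bcrb_Deliver m' pt)"
  shows "\<exists>t'<t. \<exists>pt'. ev t' = Some (i, Bcrb_Deliver m pt')"
proof -
  obtain c where c: "m = (p, local_sn (conf t1 p) + 1)" "(m, App c) \<in> sent (conf (Suc t1) p)"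
    "local_sn (conf (Suc t1) p) = snd m"
    using bcrb_broadcast_step[OF assms(1,3)] .
  obtain m': "m' = (p, local_sn (conf t2 p) + 1)" using bcrb_broadcast_step[OF assms(1,4)] by blast
  have less: "snd m < snd m'"
    using sent_conf_mono(2)[OF assms(1), of "Suc t1" t2] assms(2) c(3) m' by simp
  obtain c' where "deliverable k (conf t i) m' (App c')" using bcrb_deliver_step[OF assms(5,6)] .
  \<comment> \<open>Delivery of \<open>m'\<close> requires \<open>vec p + 1 = snd m'\<close> at
    \<open>i\<close>, so all smaller numbers of \<open>p\<close> have left already.\<close>
  then have "removed (conf t i) m"
    using less c(1) m' by (auto simp: removed_def dest: deliverableD(2))
  moreover have "x = App c" if "ev t' = Some (i, Brb_Deliver m x)" for t' x
    using brb_authentic[OF assms(5) that] sent_unique[OF assms(1) _ c(2)] assms(1) c(1) by simp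
  ultimately show ?thesis by (rule removed_application_message[OF assms(5)])
qed

lemma deliver_broadcast_safe:
  assumes "p \<in> C" "t1 < t2"
    and "ev t1 = Some (p, Bcrb_Deliver M pt1)" "ev t2 = Some (p, Bcrb_Broadcast m' pt2)"
    and "i \<in> C" "ev t = Some (i, Bcrb_Deliver m' pt)"
  shows "\<exists>t'<t. \<exists>pt'. ev t' = Some (i, Bcrb_Deliver M pt')"
proof -
  obtain c where c: "deliverable k (conf t1 p) M (App c)" using bcrb_deliver_step[OF assms(1,3)] .
  have M: "1 \<le> snd M" using deliverableD(2)[OF c] by simp
  obtain t0 where "ev t0 = Some (p, Brb_Deliver M (App c))"
    using delivered_before[OF assms(1) refl, of t1] deliverableD(1)[OF c] by blast
  \<comment> \<open>The sender of \<open>M\<close> may be Byzantine; Agreement is what gives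
    \<open>i\<close> the same ciphertext as \<open>p\<close>.\<close>
  then obtain tM where tM: "ev tM = Some (i, Brb_Deliver M (App c))"
    using brb_agreed[OF assms(5,1)] by blast
  obtain a sh where ack: "((p, a), Ack M sh (hash Cr c)) \<in> sent (conf t1 p)"
    using pending_acked[OF assms(1) refl, of t1] deliverableD(1)[OF c] by blast
  then have a: "1 \<le> a" "a \<le> local_sn (conf t1 p)" using sent_numbering[OF assms(1) refl, of t1] by auto
  obtain m': "m' = (p, local_sn (conf t2 p) + 1)" using bcrb_broadcast_step[OF assms(1,4)] by blast
  have less: "a < snd m'"
    using sent_conf_mono(2)[OF assms(1), of t1 t2] assms(2) a(2) m' by simp
  obtain c' where c': "deliverable k (conf t i) m' (App c')"
    using bcrb_deliver_step[OF assms(5,6)] .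
  note del = deliverableD[OF c']
  have ra: "removed (conf t i) (p, a)" using less m' a(1) del(2) by (simp add: removed_def)
  then obtain tA x where tA: "ev tA = Some (i, Brb_Deliver (p, a) x)"
    using delivered_before[OF assms(5) refl, of t] by blast
  \<comment> \<open>The sender \<open>p\<close> of \<open>(p, a)\<close> is correct, so authenticity
    leaves only the payload that \<open>p\<close> sent under this number.\<close>
  then have x: "x = Ack M sh (hash Cr c)"
    using brb_authentic[OF assms(5) tA] sent_unique[OF assms(1) _ ack] assms(1) by simp
  have "removed (conf t i) M"
  proof (rule ccontr)
    assume "\<not> removed (conf t i) M"
    then have *: "vec (conf t i) p \<le> a" "(Node (p, a + 1), Node M) \<in> edges (conf t i) \<or>
        \<not> is_pending (conf t i) (p, a + 1)"
      using ack_blocks[OF assms(5) refl a(1) M tA[unfolded x] tM, of t] ra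
      unfolding handled_def by blast+
    \<comment> \<open>From \<open>vec p + 1 = snd m'\<close>, \<open>vec p \<le> a\<close> and
      \<open>a < snd m'\<close>, the message \<open>m'\<close> is the direct successor of the ACK,
      which is blocked or not pending.\<close>
    have "m' = (p, a + 1)" using *(1) del(2) less m' by simp
    with *(2) del show False by (auto simp: is_pending_def)
  qed
  then show ?thesis
    by (rule removed_application_message[OF assms(5)]) (use brb_unique(2)[OF assms(5) tM] in blast)
qed

theorem weak_causal_safety: "weak_causal_safety C ev"
proof -
  have "\<exists>t'<t. \<exists>pt'. ev t' = Some (i, Bcrb_Deliver m1 pt')"
    if "causal_chain C ev m1 m2" "i \<in> C" "ev t = Some (i, Bcrb_Deliver m2 pt)" for m1 m2 i t pt
    using that(1,3)
  proof (induction arbitrary: t pt)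
    case broadcast_broadcast
    then show ?case using broadcast_broadcast_safe that(2) by blast
  next
    case deliver_broadcast
    then show ?case using deliver_broadcast_safe that(2) by blast
  next
    case trans
    \<comment> \<open>Process \<open>i\<close> first delivers the middle message at some earlier
      time; the other induction hypothesis applies at that time.\<close>
    then show ?case by (meson order.strict_trans)
  qed
  then show ?thesis unfolding weak_causal_safety_def by blast
qed

end

theorem theoremB2:
  fixes Cr :: "('p::finite, 'pk, 'sk, 'pt, 'coins, 'ct, 'share, 'h) crypto"
    and f :: nat
    and byz :: "'p set"
    and conf :: "('p, 'ct, 'share, 'h) configs"
    and ev :: "('p, 'pt, 'ct, 'share, 'h) events"
  assumes "CARD('p) \<ge> 3 * f + 1"
    and "card byz \<le> f"
    and "threshold_scheme (CARD('p) - f) Cr"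
    and "execution Cr (CARD('p) - f) (- byz) conf ev"
    and "brb_validity (- byz) conf ev"
    and "brb_agreement (- byz) ev"
    and "brb_integrity (- byz) conf ev"
  shows "weak_causal_safety (- byz) ev"
proof -
  interpret brb_execution Cr "CARD('p) - f" "- byz" conf ev
    using assms by unfold_locales
  show ?thesis by (rule weak_causal_safety)
qed

end
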